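(* Let $1<\alpha<2$, $a<b$, $T>0$, $K\ge0$, $K_\alpha>0$, let $f$ be a real function on $[a,b]\times[0,T]$ and $u^0$ a real function on $[a,b]$ with $u^0(a)=u^0(b)=0$. Then the finite difference scheme $$\delta_tU_j^{k+\frac12}+K\,\delta_{\bar x}U_j^{k+\frac12}=K_\alpha\,\delta_x^{\alpha}U_j^{k+\frac12}+f_j^{k+\frac12},\quad 0\le k\le N-1,\ 1\le j\le M-1,$$ $$U_j^0=u^0(x_j),\ 0\le j\le M,\qquad U_0^k=U_M^k=0,\ 0\le k\le N,$$ is unconditionally stable with respect to the initial values. That is, for all integers $M\ge2$, $N\ge1$ (with $h=(b-a)/M$, $\tau=T/N$, and no restriction relating $\tau$ and $h$) and every perturbation $\{\rho_j\mid 0\le j\le M\}$ with $\rho_0=\rho_M=0$, if $U_j^k$ solves the scheme and $v_j^k$ solves the same scheme with the initial condition replaced by $v_j^0=u^0(x_j)+\rho_j$, $0\le j\le M$, then $$\|\bm{U}^{k}-\bm{v}^{k}\|\le\|\bm{\rho}\|,\qquad 0\le k\le N.$$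
   Context: Grid: $x_j=a+jh$ ($0\le j\le M$), $t_k=k\tau$ ($0\le k\le N$), $t_{k+\frac12}=(k+\frac12)\tau$, $f_j^{k+\frac12}=f(x_j,t_{k+\frac12})$. The discrete norm of a grid function $\bm{w}=\{w_j\}$ with $w_0=w_M=0$ is $\|\bm{w}\|=\bigl(h\sum_{j=1}^{M-1}w_j^2\bigr)^{1/2}$; $\bm{U}^k=\{U_j^k\}_j$. Notation for grid functions: $U_j^{k+\frac12}=\frac12(U_j^{k+1}+U_j^{k})$, $\delta_tU_j^{k+\frac12}=\frac1\tau(U_j^{k+1}-U_j^k)$, $\delta_{\bar x}U_j=\frac{1}{2h}(U_{j+1}-U_{j-1})$, and $$\delta_x^{\alpha}U_j=\frac{C_\alpha}{h^{\alpha}}\left(\sum_{\ell=0}^{j+1}\kappa_{2,\ell}^{(\alpha)}U_{j-\ell+1}+\sum_{\ell=0}^{M-j+1}\kappa_{2,\ell}^{(\alpha)}U_{j+\ell-1}\right),\qquad C_\alpha=-\frac{1}{2\cos(\pi\alpha/2)},$$ where the $\kappa_{2,\ell}^{(\alpha)}$ are defined by $$\left(\frac{3\alpha-2}{2\alpha}-\frac{2(\alpha-1)}{\alpha}z+\frac{\alpha-2}{2\alpha}z^2\right)^{\alpha}=\sum_{\ell=0}^{\infty}\kappa_{2,\ell}^{(\alpha)}z^{\ell},\quad |z|<1,$$ with the branch analytic in $|z|<1$ whose value at $z=0$ is the positive number $\left(\frac{3\alpha-2}{2\alpha}\right)^{\alpha}$. *)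

theory Defs
  imports "HOL-Complex_Analysis.Complex_Analysis"
begin

definition kappa_base :: "real \<Rightarrow> complex \<Rightarrow> complex" where
  "kappa_base \<alpha> z =
     of_real ((3 * \<alpha> - 2) / (2 * \<alpha>)) - of_real (2 * (\<alpha> - 1) / \<alpha>) * z
       + of_real ((\<alpha> - 2) / (2 * \<alpha>)) * z ^ 2"

text \<open>
  The principal power is the branch meant here: for \<open>1 < \<alpha> < 2\<close> the base does not meet the
  nonpositive real axis on the open unit disc, so its principal power is analytic there
  (\<open>kappa_gen_holomorphic\<close>) and has the required positive value at \<open>0\<close> (\<open>kappa_gen_0\<close>).
\<close>

definition kappa_gen :: "real \<Rightarrow> complex \<Rightarrow> complex" where
  "kappa_gen \<alpha> z = kappa_base \<alpha> z powr of_real \<alpha>"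

text \<open>
  The Taylor coefficients of \<open>kappa_gen \<alpha>\<close> at \<open>0\<close> are real for \<open>1 < \<alpha> < 2\<close>, so \<open>Re\<close> only
  converts the type; \<open>kappa_sums\<close> is the defining power series identity.
\<close>

definition kappa :: "real \<Rightarrow> nat \<Rightarrow> real" where
  "kappa \<alpha> l = Re (fps_nth (fps_expansion (kappa_gen \<alpha>) 0) l)"

lemma kappa_base_factor:
  assumes "\<alpha> > 0"
  shows "kappa_base \<alpha> z =
    (1 - z) * (of_real ((3 * \<alpha> - 2) / (2 * \<alpha>)) + of_real ((2 - \<alpha>) / (2 * \<alpha>)) * z)"
proof -
  define A where "A = (3 * \<alpha> - 2) / (2 * \<alpha>)"
  define B where "B = (2 - \<alpha>) / (2 * \<alpha>)"
  have AB: "2 * (\<alpha> - 1) / \<alpha> = A - B" "(\<alpha> - 2) / (2 * \<alpha>) = - B"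
    using assms by (simp_all add: A_def B_def field_simps)
  show ?thesis
    unfolding kappa_base_def AB A_def [symmetric] B_def [symmetric]
    by (simp add: algebra_simps power2_eq_square)
qed

lemma kappa_base_notin_nonpos:
  assumes "1 < \<alpha>" "\<alpha> < 2" "norm z < 1"
  shows "kappa_base \<alpha> z \<notin> \<real>\<^sub>\<le>\<^sub>0"
proof
  assume *: "kappa_base \<alpha> z \<in> \<real>\<^sub>\<le>\<^sub>0"
  define A where "A = (3 * \<alpha> - 2) / (2 * \<alpha>)"
  define B where "B = (2 - \<alpha>) / (2 * \<alpha>)"
  define p where "p = 1 - z"
  define q where "q = of_real A + of_real B * z"
  have AB: "0 < B" "B < A"
    using assms by (simp_all add: A_def B_def field_simps)
  have rz: "\<bar>Re z\<bar> < 1"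
    using assms(3) abs_Re_le_cmod[of z] by linarith
  have p: "Re p > 0" using rz by (simp add: p_def)
  have "B * (- Re z) < B * 1" using AB rz by (intro mult_strict_left_mono) auto
  then have q: "Re q > 0" using AB by (simp add: q_def)
  have pq: "p * q \<in> \<real>\<^sub>\<le>\<^sub>0"
    using * assms kappa_base_factor[of \<alpha> z] by (simp add: A_def B_def p_def q_def)
  have im: "Re p * Im q + Im p * Re q = 0" and re: "Re p * Re q \<le> Im p * Im q"
    using pq by (simp_all add: complex_nonpos_Reals_iff)
  have "Re p * (Re q * Re q + Im q * Im q) = Re q * (Re p * Re q - Im p * Im q)
      + Im q * (Re p * Im q + Im p * Re q)"
    by algebra
  also have "\<dots> \<le> 0"
    using im re q by (simp add: mult_nonneg_nonpos)
  finally show False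
    using p q by (smt (verit) mult_pos_pos zero_le_square)
qed

lemma kappa_gen_holomorphic:
  assumes "1 < \<alpha>" "\<alpha> < 2"
  shows "kappa_gen \<alpha> holomorphic_on ball 0 1"
proof -
  have "kappa_base \<alpha> holomorphic_on ball 0 1"
    unfolding kappa_base_def[abs_def] by (intro holomorphic_intros)
  then have "(\<lambda>z. kappa_base \<alpha> z powr of_real \<alpha>) holomorphic_on ball 0 1"
    using kappa_base_notin_nonpos[OF assms] by (intro holomorphic_intros) auto
  then show ?thesis
    by (simp add: kappa_gen_def[abs_def])
qed

lemma kappa_gen_0:
  assumes "1 < \<alpha>"
  shows "kappa_gen \<alpha> 0 = of_real (((3 * \<alpha> - 2) / (2 * \<alpha>)) powr \<alpha>)"
    and "((3 * \<alpha> - 2) / (2 * \<alpha>)) powr \<alpha> > 0"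
proof -
  define A where "A = (3 * \<alpha> - 2) / (2 * \<alpha>)"
  have A: "A > 0" using assms by (simp add: A_def)
  then show "((3 * \<alpha> - 2) / (2 * \<alpha>)) powr \<alpha> > 0" using assms by simp
  have "kappa_gen \<alpha> 0 = of_real A powr of_real \<alpha>"
    by (simp add: kappa_gen_def kappa_base_def A_def)
  also have "\<dots> = of_real (A powr \<alpha>)"
    using A by (simp add: powr_of_real)
  finally show "kappa_gen \<alpha> 0 = of_real (((3 * \<alpha> - 2) / (2 * \<alpha>)) powr \<alpha>)"
    by (simp add: A_def)
qed

lemma kappa_sums:
  assumes "1 < \<alpha>" "\<alpha> < 2" "norm z < 1"
  shows "(\<lambda>l. of_real (kappa \<alpha> l) * z ^ l) sums (kappa_base \<alpha> z powr of_real \<alpha>)"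
proof -
  define c where "c = fps_nth (fps_expansion (kappa_gen \<alpha>) 0)"
  have c: "(\<lambda>l. c l * w ^ l) sums kappa_gen \<alpha> w" if "norm w < 1" for w
    using holomorphic_power_series[OF kappa_gen_holomorphic[OF assms(1,2)], of w] that
    by (simp add: c_def fps_expansion_def)
  have cnj: "cnj (kappa_gen \<alpha> (cnj w)) = kappa_gen \<alpha> w" if "norm w < 1" for w
  proof -
    have "kappa_base \<alpha> (cnj w) \<notin> \<real>\<^sub>\<le>\<^sub>0"
      using kappa_base_notin_nonpos[OF assms(1,2), of "cnj w"] that by simp
    then have "cnj (kappa_gen \<alpha> (cnj w)) = cnj (kappa_base \<alpha> (cnj w)) powr of_real \<alpha>"
      unfolding kappa_gen_def by (subst cnj_powr) (auto simp: complex_nonpos_Reals_iff)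
    then show ?thesis
      by (simp add: kappa_gen_def kappa_base_def)
  qed
  have "(\<lambda>l. of_real (kappa \<alpha> l) * z ^ l) sums kappa_gen \<alpha> z"
  proof -
    have "(\<lambda>l. cnj (c l * cnj z ^ l)) sums cnj (kappa_gen \<alpha> (cnj z))"
      unfolding sums_cnj using c[of "cnj z"] assms(3) by simp
    then have "(\<lambda>l. cnj (c l) * z ^ l) sums kappa_gen \<alpha> z"
      using cnj[OF assms(3)] by simp
    then have "(\<lambda>l. (c l * z ^ l + cnj (c l) * z ^ l) / 2) sums
        ((kappa_gen \<alpha> z + kappa_gen \<alpha> z) / 2)"
      using c[OF assms(3)] by (intro sums_divide sums_add)
    moreover have "(c l * z ^ l + cnj (c l) * z ^ l) / 2 = of_real (kappa \<alpha> l) * z ^ l" for l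
      using complex_add_cnj[of "c l"]
      by (simp add: kappa_def c_def flip: distrib_right)
    ultimately show ?thesis by simp
  qed
  then show ?thesis by (simp add: kappa_gen_def)
qed

text \<open>
  A grid function is indexed by \<open>nat\<close>; only the values at indices \<open>0, \<dots>, M\<close> matter.  The
  spatial operators are applied at \<open>1 \<le> j < M\<close>, where none of the index subtractions on
  \<open>nat\<close> below truncates and every index occurring lies in \<open>{0..M}\<close>.
\<close>

definition grid_norm :: "real \<Rightarrow> nat \<Rightarrow> (nat \<Rightarrow> real) \<Rightarrow> real" where
  "grid_norm h M w = sqrt (h * (\<Sum>j=1..M-1. (w j)\<^sup>2))"

definition half_avg :: "(nat \<Rightarrow> nat \<Rightarrow> real) \<Rightarrow> nat \<Rightarrow> nat \<Rightarrow> real" where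
  "half_avg U k j = (U (k + 1) j + U k j) / 2"

definition delta_t :: "real \<Rightarrow> (nat \<Rightarrow> nat \<Rightarrow> real) \<Rightarrow> nat \<Rightarrow> nat \<Rightarrow> real" where
  "delta_t \<tau> U k j = (U (k + 1) j - U k j) / \<tau>"

definition delta_xbar :: "real \<Rightarrow> (nat \<Rightarrow> real) \<Rightarrow> nat \<Rightarrow> real" where
  "delta_xbar h w j = (w (j + 1) - w (j - 1)) / (2 * h)"

definition delta_x_frac :: "real \<Rightarrow> real \<Rightarrow> nat \<Rightarrow> (nat \<Rightarrow> real) \<Rightarrow> nat \<Rightarrow> real" where
  "delta_x_frac \<alpha> h M w j =
     (- 1 / (2 * cos (pi * \<alpha> / 2))) / (h powr \<alpha>) *
       ((\<Sum>l=0..j+1. kappa \<alpha> l * w (j + 1 - l)) +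
        (\<Sum>l=0..M-j+1. kappa \<alpha> l * w (j + l - 1)))"

text \<open>
  \<open>U k j\<close> is the value at time level \<open>k\<close> and grid point \<open>j\<close>; \<open>\<phi> j\<close> is the initial value
  prescribed at grid point \<open>j\<close>.
\<close>

definition solves_scheme ::
  "real \<Rightarrow> real \<Rightarrow> real \<Rightarrow> real \<Rightarrow> real \<Rightarrow> real \<Rightarrow> (real \<Rightarrow> real \<Rightarrow> real) \<Rightarrow> nat \<Rightarrow> nat
    \<Rightarrow> (nat \<Rightarrow> real) \<Rightarrow> (nat \<Rightarrow> nat \<Rightarrow> real) \<Rightarrow> bool" where
  "solves_scheme \<alpha> a b T K K\<alpha> f M N \<phi> U \<longleftrightarrow>
     (let h = (b - a) / real M; \<tau> = T / real N in
       (\<forall>k<N. \<forall>j\<in>{1..M-1}.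
          delta_t \<tau> U k j + K * delta_xbar h (half_avg U k) j =
            K\<alpha> * delta_x_frac \<alpha> h M (half_avg U k) j
              + f (a + real j * h) ((real k + 1 / 2) * \<tau>)) \<and>
       (\<forall>j\<le>M. U 0 j = \<phi> j) \<and>
       (\<forall>k\<le>N. U k 0 = 0 \<and> U k M = 0))"

end

theory Submission
  imports Defs
begin

text \<open>
  The difference \<open>E = U - v\<close> of the two solutions solves the homogeneous scheme, so the source term
  disappears and the claim is an energy estimate.  Taking the inner product of one time step with
  the mean \<open>w\<close> of the old and the new level turns the left-hand side into
  \<open>(\<parallel>E (k + 1)\<parallel>\<^sup>2 - \<parallel>E k\<parallel>\<^sup>2) / (2 * \<tau>)\<close>, the convection term vanishes because the centred difference
  is skew (\<open>delta_xbar_skew\<close>), and everything rests on the fractional operator being dissipative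
  (\<open>delta_x_frac_dissipative\<close>): its quadratic form on grid functions that vanish at the end points
  is nonpositive.

  That quadratic form is twice a nonnegative multiple of the Toeplitz form
  \<open>\<Sum>j k. w j * w k * kappa (j + 1 - k)\<close>, with zero coefficients at negative
  indices.  The generating function \<open>g = kappa_gen \<alpha>\<close> is holomorphic in the unit disc and continuous up to its boundary, so Cauchy's formula on the unit circle itself
  represents every \<open>kappa n\<close> as a Fourier coefficient of \<open>g\<close>.  With \<open>V\<close> the trigonometric polynomial
  with coefficients \<open>w\<close>, the Toeplitz form is the mean over the circle of
  \<open>Re (cnj z * g z) * \<bar>V z\<bar>\<^sup>2\<close>.  It remains to see that the symbol \<open>Re (cnj z * g z)\<close> is nonpositive
  (\<open>Re_rotated_kappa_gen_nonpos\<close>).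

  For this, put \<open>B = (2 - \<alpha>) / (2 * \<alpha>)\<close> and factor the base of the power as
  \<open>(1 - z) * (1 - B + B * z)\<close>.  At \<open>z = cis \<theta>\<close> with \<open>0 < \<theta> < 2 * pi\<close> the two factors have the arguments
  \<open>(\<theta> - pi) / 2\<close> and \<open>\<phi>\<close>, so the phase of \<open>cnj z * g z\<close> is \<open>\<alpha> * ((\<theta> - pi) / 2 + \<phi>) - \<theta>\<close>.  The bound
  \<open>\<phi> \<le> B * \<theta>\<close> (\<open>arctan_phase_le\<close>) makes this at most \<open>- \<alpha> * pi / 2\<close>, since the multiples of \<open>\<theta>\<close> cancel
  exactly: \<open>B\<close> is the value for which the scheme has second order.  Reflecting \<open>\<theta>\<close> to
  \<open>2 * pi - \<theta>\<close> gives the lower bound \<open>\<alpha> * pi / 2 - 2 * pi\<close>.  For \<open>1 < \<alpha> < 2\<close> both lie in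
  \<open>[-3 * pi / 2, - pi / 2]\<close>, where the cosine is nonpositive.
\<close>

section \<open>The sign of the symbol on the unit circle\<close>

text \<open>
  The left-hand side is the argument of \<open>1 - B + B * cis \<theta>\<close>.  Equality holds at \<open>0\<close>, and the
  argument grows at a rate of at most \<open>B\<close>: its derivative is
  \<open>B * (1 - (1 - B) * (1 - cos \<theta>)) / (1 - 2 * B * (1 - B) * (1 - cos \<theta>))\<close>, and \<open>2 * B \<le> 1\<close>.
\<close>
lemma arctan_phase_le:
  fixes B \<theta> :: real
  assumes "0 \<le> B" "B < 1 / 2" "0 \<le> \<theta>"
  shows "arctan (B * sin \<theta> / (1 - B + B * cos \<theta>)) \<le> B * \<theta>"
proof -
  define D where "D x = 1 - B + B * cos x" for x
  define \<psi> where "\<psi> x = arctan (B * sin x / D x) - B * x" for x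
  have Dpos: "D x > 0" for x
  proof -
    have "B * (- cos x) \<le> B * 1"
      using assms cos_ge_minus_one[of x] by (intro mult_left_mono) linarith+
    then show ?thesis using assms by (simp add: D_def)
  qed
  have decreasing: "\<exists>y. DERIV \<psi> x :> y \<and> y \<le> 0" for x
  proof -
    have pyth: "(D x)\<^sup>2 + (B * sin x)\<^sup>2 = 1 - 2 * (B * (1 - B) * (1 - cos x))"
    proof -
      have "(D x)\<^sup>2 + (B * sin x)\<^sup>2 = (1 - B)\<^sup>2 + 2 * B * (1 - B) * cos x + B\<^sup>2 * ((sin x)\<^sup>2 + (cos x)\<^sup>2)"
        by (simp only: D_def power2_eq_square) algebra
      then show ?thesis unfolding sin_cos_squared_add by (simp add: power2_eq_square algebra_simps)
    qed
    have pos: "(D x)\<^sup>2 + (B * sin x)\<^sup>2 > 0"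
      using Dpos[of x] by (simp add: add_pos_nonneg)
    have deriv_arg: "((\<lambda>x. B * sin x / D x) has_real_derivative
        (B * cos x * D x + (B * sin x)\<^sup>2) / (D x)\<^sup>2) (at x)"
      using Dpos[of x] unfolding D_def
      by (auto intro!: derivative_eq_intros simp: power2_eq_square)
    have "DERIV \<psi> x :> inverse (1 + (B * sin x / D x)\<^sup>2) *
        ((B * cos x * D x + (B * sin x)\<^sup>2) / (D x)\<^sup>2) - B"
      unfolding \<psi>_def by (rule DERIV_diff[OF DERIV_chain2[OF DERIV_arctan deriv_arg] DERIV_cmult_Id])
    also have "inverse (1 + (B * sin x / D x)\<^sup>2) * ((B * cos x * D x + (B * sin x)\<^sup>2) / (D x)\<^sup>2)
        = (B * cos x * D x + (B * sin x)\<^sup>2) / ((D x)\<^sup>2 + (B * sin x)\<^sup>2)"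
    proof -
      have "1 + (B * sin x / D x)\<^sup>2 = ((D x)\<^sup>2 + (B * sin x)\<^sup>2) / (D x)\<^sup>2"
        using Dpos[of x] by (simp add: power_divide add_divide_distrib)
      moreover have "inverse (s / d) * (c / d) = c / s" if "d \<noteq> 0" for s d c :: real
        using that by (simp add: inverse_eq_divide)
      ultimately show ?thesis using Dpos[of x] by simp
    qed
    finally have der: "DERIV \<psi> x :> (B * cos x * D x + (B * sin x)\<^sup>2) / ((D x)\<^sup>2 + (B * sin x)\<^sup>2) - B" .
    have "B * cos x * D x + (B * sin x)\<^sup>2 = B * (1 - (1 - B) * (1 - cos x))"
    proof -
      have "B * cos x * D x + (B * sin x)\<^sup>2 = B * (1 - B) * cos x + B\<^sup>2 * ((sin x)\<^sup>2 + (cos x)\<^sup>2)"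
        by (simp only: D_def power2_eq_square) algebra
      then show ?thesis unfolding sin_cos_squared_add by (simp add: power2_eq_square algebra_simps)
    qed
    also have "\<dots> \<le> B * (1 - 2 * (B * (1 - B) * (1 - cos x)))"
    proof (intro mult_left_mono assms diff_left_mono)
      have "(2 * B) * ((1 - B) * (1 - cos x)) \<le> 1 * ((1 - B) * (1 - cos x))"
        using assms by (intro mult_right_mono) auto
      then show "2 * (B * (1 - B) * (1 - cos x)) \<le> (1 - B) * (1 - cos x)" by simp
    qed
    also have "\<dots> = B * ((D x)\<^sup>2 + (B * sin x)\<^sup>2)"
      by (simp only: pyth)
    finally have "(B * cos x * D x + (B * sin x)\<^sup>2) / ((D x)\<^sup>2 + (B * sin x)\<^sup>2) - B \<le> 0"
      using pos by (simp only: pos_divide_le_eq diff_le_0_iff_le)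
    with der show ?thesis by blast
  qed
  have "\<psi> \<theta> \<le> \<psi> 0"
    by (rule DERIV_nonpos_imp_nonincreasing[OF assms(3) decreasing])
  then show ?thesis by (simp add: \<psi>_def D_def)
qed

text \<open>
  The range of \<open>\<phi>\<close> is what makes \<open>\<phi>\<close> the principal argument, so that the principal power
  multiplies it by \<open>s\<close>.
\<close>
lemma rcis_powr_of_real:
  assumes "r > 0" "- pi < \<phi>" "\<phi> \<le> pi"
  shows "rcis r \<phi> powr of_real s = rcis (r powr s) (s * \<phi>)"
proof -
  have "Ln (rcis r \<phi>) = of_real (ln r) + \<i> * of_real \<phi>"
    using assms by (intro Ln_unique) (auto simp: rcis_def exp_add exp_of_real cis_conv_exp)
  then show ?thesis using assms
    by (simp add: powr_def rcis_def cis_conv_exp exp_add algebra_simps exp_of_real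
        flip: of_real_mult)
qed

text \<open>
  Both factors of the base lie in the open right half-plane, so their arguments add up to an angle
  \<open>\<beta>\<close> in \<open>(- pi, pi)\<close>, which is therefore the principal argument of the base.  The value in question is
  then a positive number times \<open>cos (\<alpha> * \<beta> - \<theta>)\<close>.
\<close>
lemma Re_rotated_kappa_gen_nonpos:
  assumes "1 < \<alpha>" "\<alpha> < 2" "0 \<le> \<theta>" "\<theta> \<le> 2 * pi"
  shows "Re (kappa_gen \<alpha> (cis \<theta>) * cis (- \<theta>)) \<le> 0"
proof (cases "\<theta> = 0 \<or> \<theta> = 2 * pi")
  case True
  then have "cis \<theta> = 1" by auto
  moreover have "kappa_base \<alpha> 1 = 0" using assms(1) by (simp add: kappa_base_factor)
  ultimately show ?thesis by (simp add: kappa_gen_def)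
next
  case False
  define B where "B = (2 - \<alpha>) / (2 * \<alpha>)"
  have B: "0 < B" "B < 1 / 2" and \<alpha>B: "\<alpha> * B = 1 - \<alpha> / 2"
    using assms by (auto simp: B_def field_simps)
  have A: "(3 * \<alpha> - 2) / (2 * \<alpha>) = 1 - B"
    using assms by (simp add: B_def field_simps)
  define q where "q = of_real (1 - B) + of_real B * cis \<theta>"
  define \<phi> where "\<phi> = arctan (B * sin \<theta> / (1 - B + B * cos \<theta>))"
  have "Re q > 0"
  proof -
    have "B * (- cos \<theta>) \<le> B * 1"
      using B cos_ge_minus_one[of \<theta>] by (intro mult_left_mono) linarith+
    then show ?thesis using B by (simp add: q_def)
  qed
  then have "Arg q = \<phi>" by (simp add: arg_conv_arctan) (simp add: q_def \<phi>_def)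
  then have q: "q = rcis (norm q) \<phi>" using rcis_cmod_Arg[of q] by simp
  have norm_q: "norm q > 0" using \<open>Re q > 0\<close> by auto
  have sin_half: "sin (\<theta> / 2) > 0"
    using assms False by (intro sin_gt_zero) auto
  have p: "1 - cis \<theta> = rcis (2 * sin (\<theta> / 2)) ((\<theta> - pi) / 2)"
  proof -
    have *: "cos \<theta> = 1 - 2 * sin (\<theta> / 2) ^ 2" "sin \<theta> = 2 * sin (\<theta> / 2) * cos (\<theta> / 2)"
      using cos_double_sin[of "\<theta> / 2"] sin_double[of "\<theta> / 2"] by simp_all
    have "cos ((\<theta> - pi) / 2) = sin (\<theta> / 2)" "sin ((\<theta> - pi) / 2) = - cos (\<theta> / 2)"
      by (simp_all add: diff_divide_distrib cos_diff sin_diff)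
    then show ?thesis by (simp add: complex_eq_iff * power2_eq_square)
  qed
  define \<beta> where "\<beta> = (\<theta> - pi) / 2 + \<phi>"
  have \<phi>: "- (pi / 2) < \<phi>" "\<phi> < pi / 2"
    unfolding \<phi>_def using arctan_bounded by auto
  have "kappa_base \<alpha> (cis \<theta>) = (1 - cis \<theta>) * q"
    using assms(1) A by (simp add: kappa_base_factor q_def B_def)
  also have "\<dots> = rcis (2 * sin (\<theta> / 2) * norm q) \<beta>"
    by (subst p, subst q) (simp add: rcis_mult \<beta>_def)
  finally have base: "kappa_base \<alpha> (cis \<theta>) = rcis (2 * sin (\<theta> / 2) * norm q) \<beta>" .
  have "kappa_gen \<alpha> (cis \<theta>) =
      rcis ((2 * sin (\<theta> / 2) * norm q) powr \<alpha>) (\<alpha> * \<beta>)"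
    unfolding kappa_gen_def base
  proof (rule rcis_powr_of_real)
    show "2 * sin (\<theta> / 2) * norm q > 0"
      using sin_half norm_q by simp
    have "- (pi / 2) < (\<theta> - pi) / 2" "(\<theta> - pi) / 2 < pi / 2"
      using assms False by simp_all
    then show "- pi < \<beta>" "\<beta> \<le> pi"
      unfolding \<beta>_def using \<phi> by linarith+
  qed
  then have "Re (kappa_gen \<alpha> (cis \<theta>) * cis (- \<theta>)) =
      (2 * sin (\<theta> / 2) * norm q) powr \<alpha> * cos (\<alpha> * \<beta> - \<theta>)"
    by (simp add: rcis_def cis_mult mult.assoc del: cis_neq_zero)
  moreover have "cos (\<alpha> * \<beta> - \<theta>) \<le> 0"
  proof -
    \<comment> \<open>the second bound is the first one at the conjugate point \<open>cis (2 * pi - \<theta>)\<close>\<close>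
    have upper: "\<phi> \<le> B * \<theta>"
      using arctan_phase_le[of B \<theta>] B assms by (simp add: \<phi>_def)
    have lower: "- \<phi> \<le> B * (2 * pi - \<theta>)"
      using arctan_phase_le[of B "2 * pi - \<theta>"] B assms
      by (simp add: \<phi>_def sin_diff cos_diff arctan_minus)
    have phase_bounds: "\<alpha> * \<phi> \<le> (\<alpha> * B) * \<theta>" "\<alpha> * (- \<phi>) \<le> (\<alpha> * B) * (2 * pi - \<theta>)"
      unfolding mult.assoc using upper lower assms by (intro mult_left_mono; simp)+
    have "\<alpha> * \<beta> - \<theta> \<le> - (\<alpha> * pi / 2)" "\<alpha> * \<beta> - \<theta> \<ge> \<alpha> * pi / 2 - 2 * pi"
    proof -
      have "\<alpha> * \<beta> = \<alpha> * \<theta> / 2 - \<alpha> * pi / 2 + \<alpha> * \<phi>"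
        by (simp add: \<beta>_def distrib_left right_diff_distrib diff_divide_distrib)
      moreover have "(\<alpha> * B) * \<theta> = \<theta> - \<alpha> * \<theta> / 2"
        by (simp add: \<alpha>B left_diff_distrib)
      moreover have "(\<alpha> * B) * (2 * pi - \<theta>) = 2 * pi - \<theta> - \<alpha> * pi + \<alpha> * \<theta> / 2"
        by (simp add: \<alpha>B left_diff_distrib right_diff_distrib)
      ultimately show "\<alpha> * \<beta> - \<theta> \<le> - (\<alpha> * pi / 2)" "\<alpha> * \<beta> - \<theta> \<ge> \<alpha> * pi / 2 - 2 * pi"
        using phase_bounds by linarith+
    qed
    moreover have "pi \<le> \<alpha> * pi" using assms by simp
    ultimately have "cos (\<alpha> * \<beta> - \<theta> + pi) \<ge> 0"
      by (intro cos_ge_zero) linarith+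
    then show ?thesis by simp
  qed
  ultimately show ?thesis by (simp add: mult_nonneg_nonpos)
qed

section \<open>The coefficients as Fourier coefficients\<close>

text \<open>
  Only the zero of the base at \<open>z = 1\<close> and its position relative to the branch cut need attention.
  The principal power with a positive exponent is continuous at \<open>0\<close> too, as long as the base stays
  off the negative real axis; and a product of a number with nonnegative and one with
  positive real part cannot be a negative real.
\<close>
lemma kappa_gen_continuous_on_cball:
  assumes "1 < \<alpha>" "\<alpha> < 2"
  shows "continuous_on (cball 0 1) (kappa_gen \<alpha>)"
  unfolding kappa_gen_def[abs_def]
proof (rule continuous_on_powr_complex)
  show "cball 0 1 \<subseteq> {z. 0 \<le> Re (kappa_base \<alpha> z) \<or> Im (kappa_base \<alpha> z) \<noteq> 0}"
  proof (intro subsetI CollectI disjCI)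
    fix z :: complex
    assume z: "z \<in> cball 0 1" and "\<not> Im (kappa_base \<alpha> z) \<noteq> 0"
    then have im: "Im (kappa_base \<alpha> z) = 0" by simp
    define B where "B = (2 - \<alpha>) / (2 * \<alpha>)"
    have B: "0 < B" "B < 1 / 2"
      using assms by (auto simp: B_def field_simps)
    define p where "p = 1 - z"
    define q where "q = of_real (1 - B) + of_real B * z"
    have base: "kappa_base \<alpha> z = p * q"
    proof -
      have "(3 * \<alpha> - 2) / (2 * \<alpha>) = 1 - B"
        using assms by (simp add: B_def field_simps)
      then show ?thesis using assms by (simp add: kappa_base_factor p_def q_def B_def)
    qed
    have rz: "\<bar>Re z\<bar> \<le> 1" using z abs_Re_le_cmod[of z] by simp
    then have p: "Re p \<ge> 0" by (simp add: p_def)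
    have "B * (- Re z) \<le> B * 1" using B rz by (intro mult_left_mono) auto
    then have q: "Re q > 0" using B by (simp add: q_def)
    \<comment> \<open>the real part of \<open>(p * q) * cnj q = p * \<bar>q\<bar>\<^sup>2\<close>\<close>
    have "Re q * Re (p * q) + Im q * Im (p * q) = Re p * (Re q * Re q + Im q * Im q)"
      by simp algebra
    then have "Re q * Re (p * q) \<ge> 0" using im p by (simp add: base)
    then show "0 \<le> Re (kappa_base \<alpha> z)" using q by (simp add: base zero_le_mult_iff)
  qed
  show "continuous_on (cball 0 1) (kappa_base \<alpha>)"
    unfolding kappa_base_def[abs_def] by (intro continuous_intros)
qed (use assms in auto)

text \<open>
  A contour integral over the unit circle, in the parametrisation by one turn \<open>t \<in> {0..1}\<close> and
  without the factor \<open>2 * pi * \<i>\<close>.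
\<close>
lemma has_integral_unit_circle:
  assumes "(f has_contour_integral (2 * of_real pi * \<i> * c)) (circlepath 0 1)"
  shows "((\<lambda>t. f (cis (2 * pi * t)) * cis (2 * pi * t)) has_integral c) {0..1}"
proof -
  have path: "circlepath 0 1 t = cis (2 * pi * t)" for t
    by (simp add: circlepath cis_conv_exp algebra_simps)
  have "((\<lambda>t. f (cis (2 * pi * t)) * (2 * pi * \<i> * cis (2 * pi * t))) has_integral
      (2 * of_real pi * \<i> * c)) {0..1}"
    using assms unfolding has_contour_integral vector_derivative_circlepath path
    by (simp add: cis_conv_exp algebra_simps)
  from has_integral_divide[OF this, of "2 * of_real pi * \<i>"]
  have "((\<lambda>t. f (cis (2 * pi * t)) * (2 * pi * \<i> * cis (2 * pi * t)) / (2 * of_real pi * \<i>))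
      has_integral c) {0..1}" by simp
  also have "(\<lambda>t. f (cis (2 * pi * t)) * (2 * pi * \<i> * cis (2 * pi * t)) / (2 * of_real pi * \<i>)) =
      (\<lambda>t. f (cis (2 * pi * t)) * cis (2 * pi * t))"
    by (simp add: fun_eq_iff field_simps)
  finally show ?thesis .
qed

text \<open>
  With zero coefficients at negative indices, sums over all grid points replace the sums in
  \<open>delta_x_frac\<close> whose ranges depend on \<open>j\<close>.
\<close>
definition kappa_ext :: "real \<Rightarrow> int \<Rightarrow> real" where
  "kappa_ext \<alpha> n = (if n < 0 then 0 else kappa \<alpha> (nat n))"

text \<open>
  For \<open>n \<ge> 0\<close> this is Cauchy's formula for the \<open>n\<close>-th derivative at \<open>0\<close>; for \<open>n = - m < 0\<close> it is
  Cauchy's formula for the value at \<open>0\<close> of the function \<open>kappa_gen \<alpha> u * u ^ m\<close>, which vanishes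
  there.  Continuity on the closed disc permits integration over the unit circle itself, where
  the symbol has a sign.
\<close>
lemma kappa_ext_has_integral:
  assumes "1 < \<alpha>" "\<alpha> < 2"
  shows "((\<lambda>t. Re (kappa_gen \<alpha> (cis (2 * pi * t)) * cis (- (2 * pi * t * of_int n))))
           has_integral kappa_ext \<alpha> n) {0..1}"
proof -
  note cont = kappa_gen_continuous_on_cball[OF assms]
  note hol = kappa_gen_holomorphic[OF assms]
  define g where "g = kappa_gen \<alpha>"
  have "\<exists>c. ((\<lambda>t. g (cis (2 * pi * t)) * cis (- (2 * pi * t * of_int n))) has_integral c) {0..1}
          \<and> Re c = kappa_ext \<alpha> n"
  proof (cases "n < 0")
    case False
    define m where "m = nat n"
    have n: "of_int n = real m" using False by (simp add: m_def)
    have "((\<lambda>u. g u / (u - 0) ^ Suc m) has_contour_integral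
        (2 * pi * \<i>) / fact m * (deriv ^^ m) g 0) (circlepath 0 1)"
      unfolding g_def
      by (rule Cauchy_has_contour_integral_higher_derivative_circlepath[OF cont hol]) simp
    then have "((\<lambda>t. g (cis (2 * pi * t)) / (cis (2 * pi * t) - 0) ^ Suc m * cis (2 * pi * t))
        has_integral ((deriv ^^ m) g 0 / fact m)) {0..1}"
      by (intro has_integral_unit_circle) simp
    moreover have "g (cis (2 * pi * t)) / (cis (2 * pi * t) - 0) ^ Suc m * cis (2 * pi * t) =
        g (cis (2 * pi * t)) * cis (- (2 * pi * t * of_int n))" for t
    proof -
      have "cis (- (2 * pi * t * real m)) = inverse (cis (2 * pi * t) ^ m)"
        unfolding Complex.DeMoivre cis_inverse by (simp add: ac_simps)
      then show ?thesis by (simp add: n field_simps)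
    qed
    ultimately have "((\<lambda>t. g (cis (2 * pi * t)) * cis (- (2 * pi * t * of_int n)))
        has_integral ((deriv ^^ m) g 0 / fact m)) {0..1}"
      by simp
    moreover have "Re ((deriv ^^ m) g 0 / fact m) = kappa_ext \<alpha> n"
      using False by (simp add: kappa_ext_def kappa_def fps_expansion_def m_def g_def)
    ultimately show ?thesis by blast
  next
    case True
    define m where "m = nat (- n)"
    have n: "of_int n = - real m" and m: "m > 0" using True by (simp_all add: m_def)
    have "((\<lambda>u. g u * u ^ m / (u - 0)) has_contour_integral
        2 * of_real pi * \<i> * (g 0 * 0 ^ m)) (circlepath 0 1)"
      unfolding g_def
      by (intro Cauchy_integral_circlepath continuous_intros holomorphic_intros cont hol) simp
    moreover have "g 0 * 0 ^ m = 0" using m by simp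
    ultimately have "((\<lambda>u. g u * u ^ m / (u - 0)) has_contour_integral
        2 * of_real pi * \<i> * 0) (circlepath 0 1)" by simp
    then have "((\<lambda>t. g (cis (2 * pi * t)) * cis (2 * pi * t) ^ m / (cis (2 * pi * t) - 0)
        * cis (2 * pi * t)) has_integral 0) {0..1}"
      by (rule has_integral_unit_circle)
    moreover have "cis (- (2 * pi * t * of_int n)) = cis (2 * pi * t) ^ m" for t
      unfolding n Complex.DeMoivre by (rule arg_cong[of _ _ cis]) simp
    ultimately have "((\<lambda>t. g (cis (2 * pi * t)) * cis (- (2 * pi * t * of_int n))) has_integral 0) {0..1}"
      by simp
    then show ?thesis using True by (auto simp: kappa_ext_def)
  qed
  then obtain c where
    "((\<lambda>t. g (cis (2 * pi * t)) * cis (- (2 * pi * t * of_int n))) has_integral c) {0..1}"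
    "Re c = kappa_ext \<alpha> n" by blast
  then show ?thesis
    using has_integral_linear[OF _ bounded_linear_Re, of _ c "{0..1}"] by (fastforce simp only: o_def g_def)
qed

section \<open>Dissipativity of the spatial operators\<close>

text \<open>
  Insert the Fourier integrals for the coefficients and collect the trigonometric factors: the
  integrand becomes the nonpositive symbol times the squared modulus of \<open>V\<close>.
\<close>
lemma kappa_quadratic_form_nonpos:
  fixes w :: "nat \<Rightarrow> real"
  assumes "1 < \<alpha>" "\<alpha> < 2" "finite I"
  shows "(\<Sum>j\<in>I. \<Sum>k\<in>I. w j * (w k * kappa_ext \<alpha> (int j + 1 - int k))) \<le> 0"
proof -
  define V where "V t = (\<Sum>j\<in>I. of_real (w j) * cis (2 * pi * t * real j))" for t :: real
  define G where "G t = kappa_gen \<alpha> (cis (2 * pi * t))" for t :: real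
  have "((\<lambda>t. \<Sum>j\<in>I. \<Sum>k\<in>I. w j * (w k * Re (G t * cis (- (2 * pi * t * of_int (int j + 1 - int k))))))
      has_integral (\<Sum>j\<in>I. \<Sum>k\<in>I. w j * (w k * kappa_ext \<alpha> (int j + 1 - int k)))) {0..1}"
    unfolding G_def
    by (intro has_integral_sum has_integral_mult_right kappa_ext_has_integral assms)
  moreover have "(\<Sum>j\<in>I. \<Sum>k\<in>I. w j * (w k * Re (G t * cis (- (2 * pi * t * of_int (int j + 1 - int k)))))) \<le> 0"
    if "t \<in> {0..1}" for t
  proof -
    have "(\<Sum>j\<in>I. \<Sum>k\<in>I. w j * (w k * Re (G t * cis (- (2 * pi * t * of_int (int j + 1 - int k))))))
        = Re (\<Sum>j\<in>I. \<Sum>k\<in>I. of_real (w j) * (of_real (w k) * (G t * cis (- (2 * pi * t * of_int (int j + 1 - int k))))))"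
      by simp
    also have "(\<Sum>j\<in>I. \<Sum>k\<in>I. of_real (w j) * (of_real (w k) * (G t * cis (- (2 * pi * t * of_int (int j + 1 - int k))))))
        = (G t * cis (- (2 * pi * t))) * (V t * cnj (V t))"
    proof -
      have "of_real (w j) * (of_real (w k) * (G t * cis (- (2 * pi * t * of_int (int j + 1 - int k)))))
         = (G t * cis (- (2 * pi * t))) * ((of_real (w k) * cis (2 * pi * t * real k))
              * (of_real (w j) * cis (- (2 * pi * t * real j))))" for j k
      proof -
        have "cis (- (2 * pi * t * of_int (int j + 1 - int k)))
           = cis (- (2 * pi * t)) * cis (2 * pi * t * real k) * cis (- (2 * pi * t * real j))"
          unfolding cis_mult by (rule arg_cong[of _ _ cis]) (simp add: algebra_simps)
        then show ?thesis by (simp only: ac_simps)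
      qed
      then have "(\<Sum>j\<in>I. \<Sum>k\<in>I. of_real (w j) * (of_real (w k) * (G t * cis (- (2 * pi * t * of_int (int j + 1 - int k))))))
        = (\<Sum>j\<in>I. \<Sum>k\<in>I. (G t * cis (- (2 * pi * t))) * ((of_real (w k) * cis (2 * pi * t * real k))
              * (of_real (w j) * cis (- (2 * pi * t * real j)))))"
        by (intro sum.cong refl)
      also have "\<dots> = (G t * cis (- (2 * pi * t))) * (V t * cnj (V t))"
        unfolding V_def cnj_sum sum_product
        by (subst sum.swap) (simp add: sum_distrib_left cis_cnj)
      finally show ?thesis .
    qed
    also have "Re \<dots> = Re (G t * cis (- (2 * pi * t))) * (cmod (V t))\<^sup>2"
      by (simp only: complex_norm_square[symmetric]) (simp del: of_real_power)
    also have "\<dots> \<le> 0"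
      unfolding G_def using that assms
      by (intro mult_nonpos_nonneg Re_rotated_kappa_gen_nonpos) auto
    finally show ?thesis .
  qed
  ultimately show ?thesis
    by (rule has_integral_le[OF _ has_integral_0])
qed

text \<open>
  On the interior grid points the operator is, up to a factor, a Toeplitz matrix plus its
  transpose.  The sums in \<open>delta_x_frac\<close> may reach the boundary indices \<open>0\<close> and \<open>M\<close>, where \<open>w\<close> vanishes.
\<close>
lemma delta_x_frac_conv_kappa_ext:
  assumes "1 \<le> j" "j \<le> M - 1" "w 0 = 0" "w M = 0"
  shows "delta_x_frac \<alpha> h M w j = (- 1 / (2 * cos (pi * \<alpha> / 2))) / (h powr \<alpha>) *
    ((\<Sum>k=1..M-1. w k * kappa_ext \<alpha> (int j + 1 - int k)) +
     (\<Sum>k=1..M-1. w k * kappa_ext \<alpha> (int k + 1 - int j)))"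
proof -
  have left: "(\<Sum>l=0..j+1. kappa \<alpha> l * w (j + 1 - l)) =
      (\<Sum>k=1..M-1. w k * kappa_ext \<alpha> (int j + 1 - int k))"
  proof -
    have "(\<Sum>l=0..j+1. kappa \<alpha> l * w (j + 1 - l)) = (\<Sum>k=0..j+1. kappa \<alpha> (j + 1 - k) * w k)"
      by (rule sum.reindex_bij_witness[of _ "\<lambda>k. j + 1 - k" "\<lambda>k. j + 1 - k"]) auto
    also have "\<dots> = (\<Sum>k=0..j+1. w k * kappa_ext \<alpha> (int j + 1 - int k))"
      by (intro sum.cong) (auto simp: kappa_ext_def nat_diff_distrib nat_add_distrib
          intro!: arg_cong[of _ _ "kappa \<alpha>"])
    also have "\<dots> = (\<Sum>k=0..M. w k * kappa_ext \<alpha> (int j + 1 - int k))"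
      using assms by (intro sum.mono_neutral_left) (auto simp: kappa_ext_def)
    also have "\<dots> = (\<Sum>k=1..M-1. w k * kappa_ext \<alpha> (int j + 1 - int k))"
    proof (intro sum.mono_neutral_right ballI)
      fix k assume "k \<in> {0..M} - {1..M-1}"
      then have "k = 0 \<or> k = M" by auto
      then show "w k * kappa_ext \<alpha> (int j + 1 - int k) = 0" using assms by auto
    qed auto
    finally show ?thesis .
  qed
  have right: "(\<Sum>l=0..M-j+1. kappa \<alpha> l * w (j + l - 1)) =
      (\<Sum>k=1..M-1. w k * kappa_ext \<alpha> (int k + 1 - int j))"
  proof -
    have "(\<Sum>l=0..M-j+1. kappa \<alpha> l * w (j + l - 1)) = (\<Sum>k=j-1..M. kappa \<alpha> (k + 1 - j) * w k)"
      using assms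
      by (intro sum.reindex_bij_witness[of _ "\<lambda>k. k + 1 - j" "\<lambda>l. j + l - 1"]) auto
    also have "\<dots> = (\<Sum>k=j-1..M. w k * kappa_ext \<alpha> (int k + 1 - int j))"
      by (intro sum.cong) (auto simp: kappa_ext_def intro!: arg_cong[of _ _ "kappa \<alpha>"])
    also have "\<dots> = (\<Sum>k=0..M. w k * kappa_ext \<alpha> (int k + 1 - int j))"
      using assms by (intro sum.mono_neutral_left) (auto simp: kappa_ext_def)
    also have "\<dots> = (\<Sum>k=1..M-1. w k * kappa_ext \<alpha> (int k + 1 - int j))"
    proof (intro sum.mono_neutral_right ballI)
      fix k assume "k \<in> {0..M} - {1..M-1}"
      then have "k = 0 \<or> k = M" by auto
      then show "w k * kappa_ext \<alpha> (int k + 1 - int j) = 0" using assms by auto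
    qed auto
    finally show ?thesis .
  qed
  show ?thesis unfolding delta_x_frac_def left right ..
qed

text \<open>
  A matrix and its transpose have the same quadratic form \<open>Q\<close>, and \<open>cos (pi * \<alpha> / 2) \<le> 0\<close> makes the
  factor \<open>c\<close> in front nonnegative.
\<close>
lemma delta_x_frac_dissipative:
  assumes "1 < \<alpha>" "\<alpha> < 2" "w 0 = 0" "w M = 0"
  shows "(\<Sum>j=1..M-1. w j * delta_x_frac \<alpha> h M w j) \<le> 0"
proof -
  define c where "c = (- 1 / (2 * cos (pi * \<alpha> / 2))) / (h powr \<alpha>)"
  define Q where "Q = (\<Sum>j=1..M-1. \<Sum>k=1..M-1. w j * (w k * kappa_ext \<alpha> (int j + 1 - int k)))"
  have "cos (pi * \<alpha> / 2) \<le> 0"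
  proof -
    have "pi \<le> pi * \<alpha>" "pi * \<alpha> \<le> pi * 2"
      using assms by (simp_all del: mult_le_cancel_left_pos add: mult_left_mono)
    then have "cos (pi * \<alpha> / 2 - pi) \<ge> 0" by (intro cos_ge_zero) linarith+
    then show ?thesis by (simp add: cos_diff)
  qed
  then have c: "c \<ge> 0" by (simp add: c_def divide_nonpos_nonneg mult_nonneg_nonpos)
  have "(\<Sum>j=1..M-1. w j * delta_x_frac \<alpha> h M w j) =
      (\<Sum>j=1..M-1. c * ((\<Sum>k=1..M-1. w j * (w k * kappa_ext \<alpha> (int j + 1 - int k))) +
         (\<Sum>k=1..M-1. w j * (w k * kappa_ext \<alpha> (int k + 1 - int j)))))"
  proof (rule sum.cong)
    fix j assume "j \<in> {1..M-1}"
    then have j: "1 \<le> j" "j \<le> M - 1" by auto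
    show "w j * delta_x_frac \<alpha> h M w j =
      c * ((\<Sum>k=1..M-1. w j * (w k * kappa_ext \<alpha> (int j + 1 - int k))) +
         (\<Sum>k=1..M-1. w j * (w k * kappa_ext \<alpha> (int k + 1 - int j))))"
      unfolding delta_x_frac_conv_kappa_ext[where w=w and M=M and j=j, OF j assms(3,4)] c_def[symmetric]
      by (simp only: sum_distrib_left[symmetric]) (simp only: algebra_simps)
  qed simp
  also have "\<dots> = c * (Q + (\<Sum>j=1..M-1. \<Sum>k=1..M-1. w j * (w k * kappa_ext \<alpha> (int k + 1 - int j))))"
    by (simp add: Q_def sum.distrib flip: sum_distrib_left)
  also have "(\<Sum>j=1..M-1. \<Sum>k=1..M-1. w j * (w k * kappa_ext \<alpha> (int k + 1 - int j))) = Q"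
    unfolding Q_def by (subst sum.swap) (simp add: mult.left_commute)
  also have "c * (Q + Q) \<le> 0"
    using kappa_quadratic_form_nonpos[OF assms(1,2), of "{1..M-1}" w] c
    by (intro mult_nonneg_nonpos) (auto simp: Q_def)
  finally show ?thesis .
qed

text \<open>
  The sum telescopes in the products \<open>p j = w j * w (j - 1)\<close> of neighbouring values, and the two
  remaining products contain a boundary value.
\<close>
lemma delta_xbar_skew:
  assumes "w 0 = 0" "w M = 0"
  shows "(\<Sum>j=1..M-1. w j * delta_xbar h w j) = 0"
proof (cases "M = 0")
  case False
  define p where "p j = w j * w (j - 1)" for j
  have "(\<Sum>j=1..M-1. w j * delta_xbar h w j) = (\<Sum>j=1..M-1. (p (Suc j) - p j) / (2 * h))"
    by (simp add: delta_xbar_def p_def algebra_simps)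
  also have "\<dots> = (\<Sum>j=1..M-1. p (Suc j) - p j) / (2 * h)"
    by (rule sum_divide_distrib[symmetric])
  also have "(\<Sum>j=1..M-1. p (Suc j) - p j) = p M - p 1"
    using sum_Suc_diff[of 1 "M - 1" p] False by simp
  also have "\<dots> = 0" using assms by (simp add: p_def)
  finally show ?thesis by simp
qed simp

section \<open>Energy estimate and stability\<close>

lemma delta_x_frac_diff:
  "delta_x_frac \<alpha> h M (\<lambda>j. x j - y j) j = delta_x_frac \<alpha> h M x j - delta_x_frac \<alpha> h M y j"
  unfolding delta_x_frac_def right_diff_distrib[of "kappa \<alpha> _"] sum_subtractf
  by (simp only: right_diff_distrib[symmetric]) (simp only: algebra_simps)

text \<open>
  The inner product of the step with the time average \<open>w\<close> of the two levels works because
  \<open>(x + y) / 2 * ((x - y) / \<tau>) = (x\<^sup>2 - y\<^sup>2) / (2 * \<tau>)\<close>, so the time difference becomes the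
  difference of the squared norms.
\<close>
lemma scheme_step_norm_le:
  assumes "1 < \<alpha>" "\<alpha> < 2" "K\<alpha> \<ge> 0" "\<tau> > 0" "h \<ge> 0"
    and bdry: "E k 0 = 0" "E k M = 0" "E (k + 1) 0 = 0" "E (k + 1) M = 0"
    and step: "\<And>j. j \<in> {1..M-1} \<Longrightarrow> delta_t \<tau> E k j + K * delta_xbar h (half_avg E k) j =
        K\<alpha> * delta_x_frac \<alpha> h M (half_avg E k) j"
  shows "grid_norm h M (E (k + 1)) \<le> grid_norm h M (E k)"
proof -
  define w where "w = half_avg E k"
  have w: "w 0 = 0" "w M = 0" using bdry by (simp_all add: w_def half_avg_def)
  have "(\<Sum>j=1..M-1. w j * delta_t \<tau> E k j) + K * (\<Sum>j=1..M-1. w j * delta_xbar h w j)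
      = (\<Sum>j=1..M-1. w j * (delta_t \<tau> E k j + K * delta_xbar h w j))"
    by (simp add: sum_distrib_left distrib_left sum.distrib mult.left_commute)
  also have "\<dots> = K\<alpha> * (\<Sum>j=1..M-1. w j * delta_x_frac \<alpha> h M w j)"
    using step by (simp add: sum_distrib_left w_def mult.left_commute)
  also have "\<dots> \<le> 0"
    using delta_x_frac_dissipative[of \<alpha> w M h] w assms by (intro mult_nonneg_nonpos) auto
  finally have "(\<Sum>j=1..M-1. w j * delta_t \<tau> E k j) \<le> 0"
    using delta_xbar_skew[of w M h] w by simp
  also have "(\<Sum>j=1..M-1. w j * delta_t \<tau> E k j) =
      ((\<Sum>j=1..M-1. (E (k + 1) j)\<^sup>2) - (\<Sum>j=1..M-1. (E k j)\<^sup>2)) / (2 * \<tau>)"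
    unfolding sum_subtractf[symmetric] sum_divide_distrib
    using assms(4)
    by (intro sum.cong) (auto simp: w_def half_avg_def delta_t_def field_simps power2_eq_square)
  finally have "(\<Sum>j=1..M-1. (E (k + 1) j)\<^sup>2) \<le> (\<Sum>j=1..M-1. (E k j)\<^sup>2)"
    using assms(4) by (simp add: divide_le_0_iff)
  then show ?thesis
    unfolding grid_norm_def using assms(5) by (intro real_sqrt_le_mono mult_left_mono)
qed

theorem theorem8:
  fixes \<alpha> a b T K K\<alpha> :: real
    and f :: "real \<Rightarrow> real \<Rightarrow> real" and u0 :: "real \<Rightarrow> real"
    and M N :: nat and \<rho> :: "nat \<Rightarrow> real" and U v :: "nat \<Rightarrow> nat \<Rightarrow> real"
  assumes "1 < \<alpha>" "\<alpha> < 2" "a < b" "T > 0" "K \<ge> 0" "K\<alpha> > 0"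
    and "u0 a = 0" "u0 b = 0"
    and "M \<ge> 2" "N \<ge> 1"
    and "\<rho> 0 = 0" "\<rho> M = 0"
    and "solves_scheme \<alpha> a b T K K\<alpha> f M N
           (\<lambda>j. u0 (a + real j * ((b - a) / real M))) U"
    and "solves_scheme \<alpha> a b T K K\<alpha> f M N
           (\<lambda>j. u0 (a + real j * ((b - a) / real M)) + \<rho> j) v"
  shows "\<forall>k\<le>N. grid_norm ((b - a) / real M) M (\<lambda>j. U k j - v k j)
              \<le> grid_norm ((b - a) / real M) M \<rho>"
proof -
  define h where "h = (b - a) / real M"
  define \<tau> where "\<tau> = T / real N"
  define E where "E k j = U k j - v k j" for k j
  have h: "h \<ge> 0" and \<tau>: "\<tau> > 0" using assms by (simp_all add: h_def \<tau>_def)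
  note U = assms(13)[unfolded solves_scheme_def Let_def, folded h_def \<tau>_def]
  note v = assms(14)[unfolded solves_scheme_def Let_def, folded h_def \<tau>_def]
  have init: "grid_norm h M (E 0) = grid_norm h M \<rho>"
    using U v by (auto simp: grid_norm_def E_def intro!: arg_cong[of _ _ sqrt] sum.cong disjI2)
  have step: "delta_t \<tau> E k j + K * delta_xbar h (half_avg E k) j =
        K\<alpha> * delta_x_frac \<alpha> h M (half_avg E k) j" if "k < N" "j \<in> {1..M-1}" for k j
  proof -
    have avg: "half_avg E k = (\<lambda>i. half_avg U k i - half_avg v k i)"
      by (auto simp: fun_eq_iff half_avg_def E_def field_simps)
    have "delta_t \<tau> E k j + K * delta_xbar h (half_avg E k) j =
        (delta_t \<tau> U k j + K * delta_xbar h (half_avg U k) j)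
        - (delta_t \<tau> v k j + K * delta_xbar h (half_avg v k) j)"
      unfolding avg by (simp add: delta_t_def delta_xbar_def E_def diff_divide_distrib add_divide_distrib algebra_simps)
    also have "\<dots> = K\<alpha> * (delta_x_frac \<alpha> h M (half_avg U k) j - delta_x_frac \<alpha> h M (half_avg v k) j)"
      using U v that by (simp add: right_diff_distrib)
    finally show ?thesis by (simp add: avg delta_x_frac_diff)
  qed
  have bdry: "E k 0 = 0" "E k M = 0" if "k \<le> N" for k
    using U v that by (simp_all add: E_def)
  have "grid_norm h M (E k) \<le> grid_norm h M \<rho>" if "k \<le> N" for k
    using that
  proof (induction k)
    case 0
    then show ?case using init by simp
  next
    case (Suc k)
    have "grid_norm h M (E (k + 1)) \<le> grid_norm h M (E k)"
      using assms Suc.prems h \<tau> bdry step by (intro scheme_step_norm_le[where \<tau>=\<tau> and \<alpha>=\<alpha> and K=K and K\<alpha>=K\<alpha>]) auto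
    then show ?case using Suc by simp
  qed
  then show ?thesis by (simp add: h_def E_def[abs_def])
qed

end
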